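(* Let $p(x)=x^{d-t}\prod_{i=1}^{t}(x-\lambda_i)$ be a real-rooted polynomial of degree $d$, where $t\leq d$ is a positive integer and $\lambda_1\geq\cdots\geq\lambda_t>0$ with $\lambda_1>\lambda_t$. Set $\alpha:=t/\sum_{i=1}^t\lambda_i^{-1}$ and $\beta:=\frac{\lambda_t^{-1}-\alpha^{-1}}{\lambda_t^{-1}-\lambda_1^{-1}}\leq 1$. Then for each integer $k$ satisfying $\beta\cdot t\leq k<t$, \[\mathrm{maxroot}\ (x^2\cdot\partial_x-d\cdot x)^k\,p(x)\leq\frac{\lambda_1}{1+(\frac{\lambda_1}{\alpha}-1)\cdot\Big(\sqrt{\frac{k}{t}}-\sqrt{\frac{\beta}{1-\beta}\cdot(1-\frac{k}{t})}\Big)^2}.\]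
   Context: $(x^2\partial_x-d\,x)$ is the operator $p\mapsto x^2p'-d\,x\,p$, and $(x^2\partial_x-d\,x)^k$ its $k$-fold composition. $\mathrm{maxroot}$ denotes the largest root. *)

theory Defs
  imports Complex_Main "HOL-Computational_Algebra.Polynomial"
begin

definition polar_op :: "nat \<Rightarrow> real poly \<Rightarrow> real poly" where
  "polar_op d p = monom 1 2 * pderiv p - smult (real d) (monom 1 1 * p)"

text \<open>Only meaningful for a nonzero polynomial with at least one real root:
  \<open>Max\<close> is unspecified on the empty set and on infinite sets.\<close>

definition maxroot :: "real poly \<Rightarrow> real" where
  "maxroot q = Max {x. poly q x = 0}"

end

theory Submission
  imports Defs "HOL-Computational_Algebra.Fundamental_Theorem_Algebra"
begin

text \<open>Reversal \<open>p(x) = x\<^sup>d q(1/x)\<close> turns the operator into \<open>- \<partial>\<close>, so the claim is a lower bound on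
  the least root of \<open>q\<^bsup>(k)\<^esup>\<close>, where \<open>q\<close> has the roots \<open>1 / \<lambda>\<^sub>i\<close>. This is a barrier argument:
  for \<open>x\<close> below the roots \<open>r\<^sub>i\<close> of \<open>q\<close> put \<open>\<Phi>\<^sub>q(x) = \<Sum>i. 1 / (r\<^sub>i - x)\<close>. Then \<open>x + 1 / \<Phi>\<^sub>q(x)\<close> is below
  the roots of \<open>q'\<close> and \<open>\<Phi>\<^sub>q\<^sub>'(x + 1 / \<Phi>\<^sub>q(x)) \<le> \<Phi>\<^sub>q(x)\<close>. After \<open>k\<close> derivatives all roots exceed
  \<open>x + k / \<Phi>\<^sub>q(x)\<close>; bounding \<open>\<Phi>\<^sub>q\<close> by convexity through the extreme roots and the mean, and
  optimising over \<open>x\<close>, gives the result.\<close>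

section \<open>Polynomials as products over lists of roots, and their logarithmic
  derivatives\<close>

declare mult_pCons_left [simp del]

text \<open>A list records multiplicities. The general coefficient ring lets the same facts serve
  over the reals and, for real-rootedness, over the complex numbers.\<close>

definition root_poly :: "'a::comm_ring_1 list \<Rightarrow> 'a poly" where
  "root_poly rs = (\<Prod>r\<leftarrow>rs. [:-r, 1:])"

lemma root_poly_simps [simp]:
  "root_poly [] = 1" "root_poly (r # rs) = [:-r, 1:] * root_poly rs"
  by (simp_all add: root_poly_def)

lemma poly_root_poly_eq_0_iff [simp]:
  fixes x :: "'a::idom"
  shows "poly (root_poly rs) x = 0 \<longleftrightarrow> x \<in> set rs"
  by (induction rs) auto

lemma root_poly_nonzero [simp]: "root_poly rs \<noteq> (0 :: 'a::idom poly)"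
  by (induction rs) auto

lemma degree_root_poly [simp]: "degree (root_poly rs :: 'a::idom poly) = length rs"
  by (induction rs) (simp_all add: degree_mult_eq)

lemma pderiv_linear_mult: "pderiv ([:-r, 1:] * q) = q + [:-r, 1:] * pderiv q"
  by (simp add: pderiv_mult pderiv_pCons add.commute)

lemma poly_pderiv_root_poly:
  fixes x :: "'a::{field, ring_char_0}"
  assumes "x \<notin> set rs"
  shows "poly (pderiv (root_poly rs)) x = poly (root_poly rs) x * (\<Sum>r\<leftarrow>rs. 1 / (x - r))"
  using assms
proof (induction rs)
  case (Cons r rs)
  have "x - r \<noteq> 0" using Cons.prems by auto
  then show ?case using Cons
    by (simp add: pderiv_linear_mult distrib_left)
qed simp

text \<open>This is \<open>q'' / q = (q' / q)^2 + (q' / q)'\<close>. It will express the barrier of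
  \<open>q'\<close> through sums over the roots of \<open>q\<close>.\<close>

lemma poly_pderiv2_root_poly:
  fixes x :: "'a::{field, ring_char_0}"
  assumes "x \<notin> set rs"
  shows "poly (pderiv (pderiv (root_poly rs))) x =
    poly (root_poly rs) x * ((\<Sum>r\<leftarrow>rs. 1 / (x - r))\<^sup>2 - (\<Sum>r\<leftarrow>rs. 1 / (x - r)\<^sup>2))"
  using assms
proof (induction rs)
  case (Cons r rs)
  have ne: "x - r \<noteq> 0" and nin: "x \<notin> set rs" using Cons.prems by auto
  have "poly (pderiv (pderiv (root_poly (r # rs)))) x =
      2 * poly (pderiv (root_poly rs)) x + (x - r) * poly (pderiv (pderiv (root_poly rs))) x"
    by (simp add: pderiv_linear_mult pderiv_add)
  also have "\<dots> = 2 * (poly (root_poly rs) x * (\<Sum>r\<leftarrow>rs. 1 / (x - r))) + (x - r) *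
      (poly (root_poly rs) x * ((\<Sum>r\<leftarrow>rs. 1 / (x - r))\<^sup>2 - (\<Sum>r\<leftarrow>rs. 1 / (x - r)\<^sup>2)))"
    using Cons.IH[OF nin] poly_pderiv_root_poly[OF nin] by simp
  also have "\<dots> = poly (root_poly (r # rs)) x *
      ((\<Sum>r\<leftarrow>r # rs. 1 / (x - r))\<^sup>2 - (\<Sum>r\<leftarrow>r # rs. 1 / (x - r)\<^sup>2))"
  proof -
    define S T where "S = (\<Sum>r\<leftarrow>rs. 1 / (x - r))" and "T = (\<Sum>r\<leftarrow>rs. 1 / (x - r)\<^sup>2)"
    define i P where "i = 1 / (x - r)" and "P = poly (root_poly rs) x"
    have i: "(x - r) * i = 1" using ne by (simp add: i_def)
    have "2 * (P * S) + (x - r) * (P * (S\<^sup>2 - T)) = ((x - r) * P) * ((i + S)\<^sup>2 - (i\<^sup>2 + T))"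
      using i by algebra
    then show ?thesis
      by (simp add: S_def T_def i_def P_def power_one_over)
  qed
  finally show ?case .
qed simp

section \<open>Real-rootedness is inherited by derivatives\<close>

abbreviation complexify :: "real poly \<Rightarrow> complex poly" where
  "complexify \<equiv> map_poly complex_of_real"

lemma complexify_mult: "complexify (p * q) = complexify p * complexify q"
  by (simp add: poly_eq_iff coeff_map_poly coeff_mult)

lemma complexify_pderiv: "complexify (pderiv p) = pderiv (complexify p)"
  by (simp add: poly_eq_iff coeff_map_poly coeff_pderiv)

lemma complexify_root_poly: "complexify (root_poly rs) = root_poly (map complex_of_real rs)"
  by (induction rs) (simp_all add: complexify_mult map_poly_pCons)

lemma poly_complexify_of_real: "poly (complexify p) (of_real x) = of_real (poly p x)"
  by (induction p) (simp_all add: map_poly_pCons)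

text \<open>The fundamental theorem of algebra supplies a complex root, which is real by hypothesis.
  Dividing it off lowers the degree and creates no new roots.\<close>

lemma real_rooted_splits:
  assumes "p \<noteq> 0" and "\<And>z. poly (complexify p) z = 0 \<Longrightarrow> z \<in> \<real>"
  shows "\<exists>c rs. c \<noteq> 0 \<and> p = smult c (root_poly rs)"
  using assms
proof (induction "degree p" arbitrary: p)
  case 0
  then obtain c where "p = [:c:]" by (metis degree_eq_zeroE)
  with 0 show ?case by (intro exI[of _ c] exI[of _ "[]"]) (auto simp: smult_one)
next
  case (Suc n)
  have "degree (complexify p) = Suc n"
    using Suc.hyps(2) by (subst degree_map_poly) auto
  then have "\<not> constant (poly (complexify p))" by (simp add: constant_degree)
  then obtain z where z: "poly (complexify p) z = 0"
    using fundamental_theorem_of_algebra by blast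
  then obtain x where x: "z = of_real x" using Suc.prems(2) by (auto elim: Reals_cases)
  with z have "poly p x = 0" by (simp add: poly_complexify_of_real)
  then obtain p1 where p1: "p = [:-x, 1:] * p1" by (auto simp: poly_eq_0_iff_dvd elim: dvdE)
  have ne: "p1 \<noteq> 0" using p1 Suc.prems(1) by auto
  have "degree p = 1 + degree p1"
    unfolding p1 using ne by (subst degree_mult_eq) auto
  then have "n = degree p1" using Suc.hyps(2) by simp
  moreover have "w \<in> \<real>" if "poly (complexify p1) w = 0" for w
    using that by (intro Suc.prems(2)) (simp add: p1 complexify_mult)
  ultimately obtain c rs where "c \<noteq> 0" "p1 = smult c (root_poly rs)"
    using Suc.hyps(1) ne by blast
  then show ?case
    by (intro exI[of _ c] exI[of _ "x # rs"]) (simp add: p1)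
qed

text \<open>Off the real axis the imaginary parts of the summands \<open>1 / (z - r)\<close> of the logarithmic
  derivative all have the same strict sign.\<close>

lemma pderiv_root_poly_splits:
  fixes rs :: "real list"
  assumes "rs \<noteq> []"
  shows "\<exists>c rs'. c \<noteq> 0 \<and> length rs' = length rs - 1 \<and> pderiv (root_poly rs) = smult c (root_poly rs')"
proof -
  have deg: "degree (pderiv (root_poly rs)) = length rs - 1"
    by (simp add: degree_pderiv)
  have ne: "pderiv (root_poly rs) \<noteq> 0"
    using assms by (simp add: pderiv_eq_0_iff)
  have "z \<in> \<real>" if z: "poly (complexify (pderiv (root_poly rs))) z = 0" for z
  proof (rule ccontr)
    assume nz: "z \<notin> \<real>"
    then have im: "Im z \<noteq> 0" by (simp add: complex_is_Real_iff)
    have zr: "z \<notin> set (map of_real rs)" using nz by auto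
    have "(\<Sum>r\<leftarrow>map complex_of_real rs. 1 / (z - r)) = 0"
      using z zr
      by (simp add: complexify_pderiv complexify_root_poly poly_pderiv_root_poly[OF zr])
    then have "Im (\<Sum>r\<leftarrow>rs. 1 / (z - complex_of_real r)) = 0" by (simp add: o_def)
    moreover have "Im (\<Sum>r\<leftarrow>rs. 1 / (z - complex_of_real r)) =
        - Im z * (\<Sum>r\<leftarrow>rs. 1 / (cmod (z - complex_of_real r))\<^sup>2)"
      by (induction rs) (simp_all add: Im_divide cmod_def algebra_simps)
    moreover have "(\<Sum>r\<leftarrow>rs. 1 / (cmod (z - complex_of_real r))\<^sup>2) > 0"
    proof -
      have *: "1 / (cmod (z - complex_of_real r))\<^sup>2 > 0" for r using nz by auto
      have "(\<Sum>r\<leftarrow>rs. 0) < (\<Sum>r\<leftarrow>rs. 1 / (cmod (z - complex_of_real r))\<^sup>2)"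
        using assms * by (intro sum_list_strict_mono) auto
      then show ?thesis by simp
    qed
    ultimately show False using im by simp
  qed
  then obtain c rs' where "c \<noteq> 0" "pderiv (root_poly rs) = smult c (root_poly rs')"
    using real_rooted_splits[OF ne] by blast
  then show ?thesis using deg by auto
qed

section \<open>The barrier function and its behaviour under one derivative\<close>

definition barrier :: "real list \<Rightarrow> real \<Rightarrow> real" where
  "barrier rs x = (\<Sum>r\<leftarrow>rs. 1 / (r - x))"

lemma barrier_minus: "(\<Sum>r\<leftarrow>rs. 1 / (x - r)) = - barrier rs x"
proof (induction rs)
  case (Cons r rs)
  have "1 / (x - r) = - (1 / (r - x))" by (metis minus_diff_eq minus_divide_right)
  then show ?case using Cons by (simp add: barrier_def)
qed (simp add: barrier_def)

lemma barrier_pos: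
  assumes "rs \<noteq> []" "\<forall>r\<in>set rs. x < r"
  shows "0 < barrier rs x"
proof -
  have "(\<Sum>r\<leftarrow>rs. 0) < barrier rs x"
    unfolding barrier_def using assms by (intro sum_list_strict_mono) auto
  then show ?thesis by simp
qed

lemma barrier_nonneg:
  assumes "\<forall>r\<in>set rs. x < r"
  shows "0 \<le> barrier rs x"
  using barrier_pos[of rs x] assms by (cases "rs = []") (auto simp: barrier_def)

text \<open>One summand \<open>1 / (r - x)\<close> is strictly smaller than the whole sum, because a
  second positive summand remains. Taking reciprocals gives the claim.\<close>

lemma barrier_shift_below_roots:
  assumes "length rs \<ge> 2" "\<forall>r\<in>set rs. x < r" "r \<in> set rs"
  shows "x + 1 / barrier rs x < r"
proof -
  obtain us vs where rs: "rs = us @ r # vs" using assms(3) by (meson split_list)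
  have split: "barrier rs x = 1 / (r - x) + barrier (us @ vs) x"
    by (simp add: rs barrier_def)
  have "barrier (us @ vs) x > 0"
    using assms by (intro barrier_pos) (auto simp: rs)
  then have "1 / (r - x) < barrier rs x" using split by simp
  moreover have "r - x > 0" using assms by auto
  ultimately show ?thesis
    using less_imp_inverse_less[of "1 / (r - x)" "barrier rs x"] by (simp add: inverse_eq_divide)
qed

text \<open>The variance of \<open>g\<close> under the weights \<open>w\<close> is
  nonnegative.\<close>

lemma sum_list_jensen_square:
  fixes w g :: "'a \<Rightarrow> real"
  assumes "\<And>x. x \<in> set xs \<Longrightarrow> 0 \<le> w x" and "(\<Sum>x\<leftarrow>xs. w x) = 1"
  shows "(\<Sum>x\<leftarrow>xs. w x * g x)\<^sup>2 \<le> (\<Sum>x\<leftarrow>xs. w x * (g x)\<^sup>2)"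
proof -
  define S where "S = (\<Sum>x\<leftarrow>xs. w x * g x)"
  have "0 \<le> (\<Sum>x\<leftarrow>xs. w x * (g x - S)\<^sup>2)"
    using assms(1) by (intro sum_list_nonneg) auto
  also have "\<dots> = (\<Sum>x\<leftarrow>xs. w x * (g x)\<^sup>2) - 2 * S * (\<Sum>x\<leftarrow>xs. w x * g x) + S\<^sup>2 * (\<Sum>x\<leftarrow>xs. w x)"
    by (induction xs) (simp_all add: algebra_simps power2_eq_square)
  also have "\<dots> = (\<Sum>x\<leftarrow>xs. w x * (g x)\<^sup>2) - S\<^sup>2"
    using assms(2) by (simp add: S_def power2_eq_square)
  finally show ?thesis by (simp add: S_def)
qed

text \<open>The weights \<open>w r\<close> sum to \<open>1\<close> and \<open>g = w / (1 - w)\<close>, which reduces the claim to Jensen's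
  inequality \<open>(\<Sum> w g)\<^sup>2 \<le> \<Sum> w g\<^sup>2\<close>.\<close>

lemma barrier_shift_inequality:
  assumes "length rs \<ge> 2" "\<forall>r\<in>set rs. x < r"
  defines "y \<equiv> x + 1 / barrier rs x"
  shows "barrier rs y - (\<Sum>r\<leftarrow>rs. 1 / (r - y)\<^sup>2) / barrier rs y \<le> barrier rs x"
proof -
  define \<phi> where "\<phi> = barrier rs x"
  define w where "w r = 1 / (\<phi> * (r - x))" for r
  define g where "g r = 1 / (\<phi> * (r - y))" for r
  have ne: "rs \<noteq> []" using assms(1) by auto
  have \<phi>: "\<phi> > 0" unfolding \<phi>_def by (rule barrier_pos) (use ne assms in auto)
  have ylt: "y < r" if "r \<in> set rs" for r
    unfolding y_def by (rule barrier_shift_below_roots) (use assms that in auto)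
  have yeq: "y = x + 1 / \<phi>" by (simp add: y_def \<phi>_def)
  have w1: "(\<Sum>r\<leftarrow>rs. w r) = 1"
  proof -
    have "(\<Sum>r\<leftarrow>rs. w r) = (\<Sum>r\<leftarrow>rs. (1 / \<phi>) * (1 / (r - x)))"
      by (simp add: w_def)
    also have "\<dots> = (1 / \<phi>) * \<phi>" unfolding sum_list_const_mult \<phi>_def barrier_def ..
    finally show ?thesis using \<phi> by simp
  qed
  have g_eq: "g r = w r + w r * g r" "(g r)\<^sup>2 = w r * g r + w r * (g r)\<^sup>2" if "r \<in> set rs" for r
  proof -
    \<comment> \<open>Shifting by \<open>1 / \<phi>\<close> lowers the reciprocal of the weight by
      exactly 1, whence \<open>g = w / (1 - w)\<close>.\<close>
    have a: "\<phi> * (r - x) = \<phi> * (r - y) + 1" using \<phi> by (simp add: yeq field_simps)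
    have pos: "\<phi> * (r - y) > 0" using \<phi> ylt[OF that] by simp
    show 1: "g r = w r + w r * g r"
      unfolding w_def g_def a using pos by (simp add: divide_simps) (use \<phi> ylt[OF that] in auto)
    show "(g r)\<^sup>2 = w r * g r + w r * (g r)\<^sup>2"
      using 1 by algebra
  qed
  define S where "S = (\<Sum>r\<leftarrow>rs. w r * g r)"
  have By: "barrier rs y = \<phi> * (1 + S)"
  proof -
    have "barrier rs y = (\<Sum>r\<leftarrow>rs. \<phi> * g r)"
      unfolding barrier_def g_def using \<phi> by simp
    also have "\<dots> = \<phi> * (\<Sum>r\<leftarrow>rs. g r)" by (rule sum_list_const_mult)
    also have "(\<Sum>r\<leftarrow>rs. g r) = (\<Sum>r\<leftarrow>rs. w r + w r * g r)"
      using g_eq(1) by (intro arg_cong[of _ _ sum_list] map_cong) auto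
    also have "\<dots> = 1 + S" by (simp add: sum_list_addf w1 S_def)
    finally show ?thesis .
  qed
  have "(\<Sum>r\<leftarrow>rs. 1 / (r - y)\<^sup>2) = (\<Sum>r\<leftarrow>rs. \<phi>\<^sup>2 * (g r)\<^sup>2)"
    using \<phi> by (simp add: g_def power_divide power_mult_distrib)
  also have "\<dots> = \<phi>\<^sup>2 * (\<Sum>r\<leftarrow>rs. (g r)\<^sup>2)" by (rule sum_list_const_mult)
  also have "(\<Sum>r\<leftarrow>rs. (g r)\<^sup>2) = (\<Sum>r\<leftarrow>rs. w r * g r + w r * (g r)\<^sup>2)"
    using g_eq(2) by (intro arg_cong[of _ _ sum_list] map_cong) auto
  also have "\<dots> = S + (\<Sum>r\<leftarrow>rs. w r * (g r)\<^sup>2)" by (simp add: sum_list_addf S_def)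
  finally have T: "(\<Sum>r\<leftarrow>rs. 1 / (r - y)\<^sup>2) = \<phi>\<^sup>2 * (S + (\<Sum>r\<leftarrow>rs. w r * (g r)\<^sup>2))" .
  \<comment> \<open>By \<open>By\<close> and \<open>T\<close>, what remains is
    \<open>S * (1 + S) <= S + (sum of w g^2)\<close>, and \<open>S\<close> cancels.\<close>
  have "S\<^sup>2 \<le> (\<Sum>r\<leftarrow>rs. w r * (g r)\<^sup>2)"
    unfolding S_def using w1 \<phi> assms(2) by (intro sum_list_jensen_square) (auto simp: w_def)
  then have "\<phi>\<^sup>2 * (S * (1 + S)) \<le> (\<Sum>r\<leftarrow>rs. 1 / (r - y)\<^sup>2)"
    unfolding T using \<phi> by (intro mult_left_mono) (auto simp: power2_eq_square algebra_simps)
  moreover have "barrier rs y > 0" using ne ylt by (intro barrier_pos) auto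
  ultimately have "barrier rs y * (\<phi> * S) \<le> (\<Sum>r\<leftarrow>rs. 1 / (r - y)\<^sup>2)"
    unfolding By by (simp add: power2_eq_square algebra_simps)
  then have "\<phi> * S \<le> (\<Sum>r\<leftarrow>rs. 1 / (r - y)\<^sup>2) / barrier rs y"
    using \<open>barrier rs y > 0\<close> by (simp add: pos_le_divide_eq mult.commute)
  then show ?thesis using By by (simp add: \<phi>_def algebra_simps)
qed

text \<open>Below all roots of \<open>q\<close> the quotient \<open>q' / q = -\<Phi>\<close> is
  nonzero, so no root of \<open>q'\<close> is at most \<open>y\<close>. At \<open>y\<close> the
  barrier of \<open>q'\<close> is \<open>-q'' / q'\<close>, which is the left side of
  \<open>barrier_shift_inequality\<close>.\<close>

lemma pderiv_barrier_step:
  assumes "length rs \<ge> 2" "\<forall>r\<in>set rs. x < r"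
  defines "y \<equiv> x + 1 / barrier rs x"
  obtains c rs' where "c \<noteq> 0" "length rs' = length rs - 1"
    "pderiv (root_poly rs) = smult c (root_poly rs')"
    "\<forall>r\<in>set rs'. y < r" "barrier rs' y \<le> barrier rs x"
proof -
  have ne: "rs \<noteq> []" using assms(1) by auto
  obtain c rs' where c: "c \<noteq> 0" and len: "length rs' = length rs - 1"
    and eq: "pderiv (root_poly rs) = smult c (root_poly rs')"
    using pderiv_root_poly_splits[OF ne] by blast
  have ylt: "y < r" if "r \<in> set rs" for r
    unfolding y_def by (rule barrier_shift_below_roots) (use assms that in auto)
  have By: "barrier rs y > 0" using ne ylt by (intro barrier_pos) auto
  have below: "y < u" if "u \<in> set rs'" for u
  proof (rule ccontr)
    assume "\<not> y < u"
    then have lt: "\<forall>r\<in>set rs. u < r" using ylt by force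
    then have nin: "u \<notin> set rs" by auto
    have "poly (pderiv (root_poly rs)) u = 0" using that by (simp add: eq)
    then have "barrier rs u = 0"
      using nin by (simp add: poly_pderiv_root_poly[OF nin] barrier_minus)
    then show False using barrier_pos[OF ne lt] by simp
  qed
  have nin: "y \<notin> set rs" "y \<notin> set rs'" using ylt below by auto
  have sq: "(\<Sum>r\<leftarrow>rs. 1 / (y - r)\<^sup>2) = (\<Sum>r\<leftarrow>rs. 1 / (r - y)\<^sup>2)"
    by (simp add: power2_commute)
  have "poly (pderiv (pderiv (root_poly rs))) y =
      - poly (pderiv (root_poly rs)) y * barrier rs' y"
    by (simp add: eq pderiv_smult poly_pderiv_root_poly[OF nin(2)] barrier_minus)
  then have "poly (root_poly rs) y * ((barrier rs y)\<^sup>2 - (\<Sum>r\<leftarrow>rs. 1 / (r - y)\<^sup>2)) =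
      poly (root_poly rs) y * (barrier rs y * barrier rs' y)"
    by (simp add: poly_pderiv2_root_poly[OF nin(1)] poly_pderiv_root_poly[OF nin(1)] barrier_minus sq)
  then have "(barrier rs y)\<^sup>2 - (\<Sum>r\<leftarrow>rs. 1 / (r - y)\<^sup>2) = barrier rs y * barrier rs' y"
    using nin by simp
  then have "barrier rs' y = barrier rs y - (\<Sum>r\<leftarrow>rs. 1 / (r - y)\<^sup>2) / barrier rs y"
    using By by (simp add: field_simps power2_eq_square)
  also have "\<dots> \<le> barrier rs x"
    unfolding y_def by (rule barrier_shift_inequality) (use assms in auto)
  finally show thesis using that c len eq below by blast
qed

section \<open>Iterating the barrier step\<close>

lemma funpow_pderiv_smult: "(pderiv ^^ k) (smult c p) = smult c ((pderiv ^^ k) p)"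
  by (induction k) (simp_all add: pderiv_smult)

text \<open>Each derivative moves the point by the reciprocal of the current barrier value. These
  values never grow, so every move is at least \<open>1 / barrier rs x\<close>.\<close>

lemma higher_pderiv_barrier:
  assumes "k < length rs" "\<forall>r\<in>set rs. x < r"
  obtains c rs' where "c \<noteq> 0" "length rs' = length rs - k"
    "(pderiv ^^ k) (root_poly rs) = smult c (root_poly rs')"
    "\<forall>r\<in>set rs'. x + real k / barrier rs x < r"
  using assms
proof (induction k arbitrary: rs x thesis)
  case 0
  then show ?case by (auto intro!: 0(1)[of 1 rs])
next
  case (Suc k)
  define y where "y = x + 1 / barrier rs x"
  \<comment> \<open>Since \<open>Suc k < length rs\<close>, at least one root survives all
    derivatives, so two are present before each of them.\<close>
  have len: "length rs \<ge> 2" using Suc.prems(2) by auto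
  obtain c rs' where 1: "c \<noteq> 0" "length rs' = length rs - 1"
    "pderiv (root_poly rs) = smult c (root_poly rs')"
    "\<forall>r\<in>set rs'. y < r" "barrier rs' y \<le> barrier rs x"
    using pderiv_barrier_step[OF len Suc.prems(3)] unfolding y_def by metis
  have "k < length rs'" using Suc.prems(2) 1(2) by simp
  from Suc.IH[OF _ this 1(4)] obtain c2 rs2 where 2: "c2 \<noteq> 0" "length rs2 = length rs' - k"
    "(pderiv ^^ k) (root_poly rs') = smult c2 (root_poly rs2)"
    "\<forall>r\<in>set rs2. y + real k / barrier rs' y < r"
    by metis
  have "rs' \<noteq> []" using \<open>k < length rs'\<close> by auto
  then have "real k / barrier rs x \<le> real k / barrier rs' y"
    using 1 barrier_pos[OF _ 1(4)] by (intro divide_left_mono) (auto intro: mult_pos_pos)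
  then have "x + real (Suc k) / barrier rs x \<le> y + real k / barrier rs' y"
    by (simp add: y_def add_divide_distrib)
  then have b: "\<forall>r\<in>set rs2. x + real (Suc k) / barrier rs x < r" using 2(4) by force
  have "(pderiv ^^ Suc k) (root_poly rs) = smult (c * c2) (root_poly rs2)"
    by (simp only: funpow_Suc_right o_apply 1(3) funpow_pderiv_smult 2(3) smult_smult)
  then show ?case using Suc.prems(1)[of "c * c2" rs2] 1 2 b by simp
qed

lemma higher_pderiv_splits:
  fixes rs :: "real list"
  assumes "k < length rs"
  obtains c rs' where "c \<noteq> 0" "length rs' = length rs - k"
    "(pderiv ^^ k) (root_poly rs) = smult c (root_poly rs')"
proof -
  \<comment> \<open>Any point below the roots will do, as only the splitting is kept.\<close>
  have "\<forall>r\<in>set rs. Min (set rs) - 1 < r"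
    by (metis List.finite_set Min_le diff_less_eq less_add_one order_le_less_trans)
  then show thesis using higher_pderiv_barrier[OF assms] that by metis
qed

lemma higher_pderiv_root_gt:
  assumes "k < length rs" "\<forall>r\<in>set rs. x < r" "poly ((pderiv ^^ k) (root_poly rs)) u = 0"
  shows "x + real k / barrier rs x < u"
  using higher_pderiv_barrier[OF assms(1,2)] assms(3)
  by (metis mult_eq_0_iff poly_root_poly_eq_0_iff poly_smult)

section \<open>Convexity bound for the barrier and choice of the starting point\<close>

text \<open>Convexity of \<open>r \<mapsto> 1 / (r - x)\<close> on \<open>[a, b]\<close>.\<close>

lemma barrier_le_chord:
  assumes "x < a" "a < b" "\<forall>r\<in>set rs. a \<le> r \<and> r \<le> b"
  shows "barrier rs x \<le> (\<Sum>r\<leftarrow>rs. b - r) / (b - a) / (a - x) + (\<Sum>r\<leftarrow>rs. r - a) / (b - a) / (b - x)"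
  using assms(3)
proof (induction rs)
  case (Cons r rs)
  have r: "a \<le> r" "r \<le> b" using Cons.prems by auto
  \<comment> \<open>The gap between chord and function is an explicit quotient with visible
    sign.\<close>
  have "(b - r) / (b - a) / (a - x) + (r - a) / (b - a) / (b - x) - 1 / (r - x) =
      (b - r) * (r - a) / ((a - x) * (b - x) * (r - x))"
  proof -
    have ne: "b - a \<noteq> 0" "a - x \<noteq> 0" "b - x \<noteq> 0" "r - x \<noteq> 0" using r assms(1,2) by auto
    then have "(b - r) / (b - a) / (a - x) + (r - a) / (b - a) / (b - x) - 1 / (r - x) =
       ((b - r) * (b - x) * (r - x) + (r - a) * (a - x) * (r - x) - (b - a) * (a - x) * (b - x)) /
       ((b - a) * ((a - x) * (b - x) * (r - x)))"
      by (simp add: add_frac_eq diff_frac_eq ac_simps) (simp add: divide_simps, simp add: algebra_simps)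
    also have "(b - r) * (b - x) * (r - x) + (r - a) * (a - x) * (r - x) - (b - a) * (a - x) * (b - x) =
       (b - a) * ((b - r) * (r - a))"
      by algebra
    finally show ?thesis using ne by simp
  qed
  also have "\<dots> \<ge> 0" using r assms(1,2) by (intro divide_nonneg_pos mult_nonneg_nonneg mult_pos_pos) auto
  finally have "1 / (r - x) \<le> (b - r) / (b - a) / (a - x) + (r - a) / (b - a) / (b - x)" by simp
  with Cons show ?case by (simp add: barrier_def add_divide_distrib)
qed (simp add: barrier_def)

text \<open>With \<open>h = sqrt \<kappa>\<close> and \<open>g = sqrt (\<beta> / (1 - \<beta>) * (1 - \<kappa>))\<close>, the lower bound
  \<open>x + k / barrier rs x\<close> is optimal at \<open>x = a - (b - a) * y\<close> with \<open>y = \<beta> * (h - g) / g\<close>.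
  When \<open>h = g\<close> this degenerates to \<open>x = a\<close>, which only is a limit of admissible points.\<close>

lemma higher_pderiv_root_ge:
  fixes a b \<beta> :: real and rs :: "real list"
  defines "n \<equiv> length rs"
  assumes ab: "a < b" and mem: "\<forall>r\<in>set rs. a \<le> r \<and> r \<le> b"
    and mean: "(\<Sum>r\<leftarrow>rs. b - r) = \<beta> * (b - a) * real n" and \<beta>: "0 < \<beta>" "\<beta> < 1"
    and k: "\<beta> * real n \<le> real k" "k < n"
    and root: "poly ((pderiv ^^ k) (root_poly rs)) u = 0"
  shows "a + (b - a) * (1 - \<beta>) * (sqrt (k / n) - sqrt (\<beta> / (1 - \<beta>) * (1 - k / n)))\<^sup>2 \<le> u"
proof -
  define \<kappa> where "\<kappa> = real k / real n"
  define h where "h = sqrt \<kappa>"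
  define g where "g = sqrt (\<beta> / (1 - \<beta>) * (1 - \<kappa>))"
  have n: "real n > 0" using k by simp
  have \<kappa>: "\<beta> \<le> \<kappa>" "\<kappa> < 1" using k n by (simp_all add: \<kappa>_def field_simps)
  have h: "h > 0" "h\<^sup>2 = \<kappa>" using \<kappa> \<beta> by (simp_all add: h_def)
  have g: "g > 0" and gsq: "g\<^sup>2 = \<beta> / (1 - \<beta>) * (1 - \<kappa>)" using \<kappa> \<beta> by (simp_all add: g_def)
  then have g2: "g\<^sup>2 * (1 - \<beta>) = \<beta> * (1 - \<kappa>)" using \<beta> by simp
  \<comment> \<open>After clearing denominators this is \<open>\<beta> <= \<kappa>\<close>: the
    lower bound on \<open>k\<close> is what makes \<open>y\<close> nonnegative.\<close>
  have "\<beta> / (1 - \<beta>) * (1 - \<kappa>) \<le> \<kappa>" using \<kappa> \<beta> by (simp add: field_simps)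
  then have gh: "g \<le> h" by (simp add: g_def h_def)
  have below: "x + real k / barrier rs x < u" if "x < a" for x
    using that mem k root by (intro higher_pderiv_root_gt) (auto simp: n_def)
  have "a + (b - a) * (1 - \<beta>) * (h - g)\<^sup>2 \<le> u"
  proof (cases "g = h")
    case True
    have "x \<le> u" if "x < a" for x
    proof -
      have "0 \<le> real k / barrier rs x" using that mem by (intro divide_nonneg_nonneg barrier_nonneg) auto
      then show ?thesis using below[OF that] by linarith
    qed
    then show ?thesis using True by (simp add: dense_le)
  next
    case False
    \<comment> \<open>In units of \<open>b - a\<close> the gain over \<open>a\<close> is
      \<open>\<kappa> * y * (1 + y) / (\<beta> + y) - y\<close>. Its derivative vanishes at
      \<open>\<beta> + y = \<beta> * h / g\<close>.\<close>
    define y where "y = \<beta> * (h - g) / g"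
    define x where "x = a - (b - a) * y"
    have y: "y > 0" using False gh g \<beta> by (simp add: y_def)
    have xa: "x < a" using y ab by (simp add: x_def)
    define D where "D = real n / (b - a) * (\<beta> / y + (1 - \<beta>) / (1 + y))"
    have mean': "(\<Sum>r\<leftarrow>rs. r - a) = (1 - \<beta>) * (b - a) * real n"
    proof -
      have "(\<Sum>r\<leftarrow>rs. r - a) + (\<Sum>r\<leftarrow>rs. b - r) = (b - a) * real n"
        unfolding n_def by (induction rs) (simp_all add: algebra_simps)
      then show ?thesis unfolding mean by (simp add: algebra_simps)
    qed
    have ax: "a - x = (b - a) * y" "b - x = (b - a) * (1 + y)"
      by (simp_all add: x_def algebra_simps)
    have "barrier rs x \<le> (\<Sum>r\<leftarrow>rs. b - r) / (b - a) / (a - x) + (\<Sum>r\<leftarrow>rs. r - a) / (b - a) / (b - x)"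
      by (rule barrier_le_chord[OF xa ab mem])
    also have "\<dots> = D"
      unfolding mean mean' ax D_def using ab y by (simp add: divide_simps) (simp add: algebra_simps)
    finally have D: "barrier rs x \<le> D" .
    have "rs \<noteq> []" using n by (auto simp: n_def)
    then have "barrier rs x > 0" using mem xa by (intro barrier_pos) auto
    then have le: "real k / D \<le> real k / barrier rs x"
      using D by (intro divide_left_mono) auto
    have "\<beta> / y + (1 - \<beta>) / (1 + y) = (\<beta> + y) / (y * (1 + y))"
      using y by (simp add: divide_simps) (simp add: algebra_simps)
    then have "real k / D = (b - a) * (\<kappa> * (1 + y) * (y / (\<beta> + y)))"
      unfolding D_def \<kappa>_def using n ab y \<beta> by (simp add: divide_simps)
    also have "\<beta> + y = \<beta> * h / g" using g by (simp add: y_def field_simps)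
    also have "y / (\<beta> * h / g) = (h - g) / h" using g h \<beta> by (simp add: y_def)
    also have "\<kappa> * (1 + y) * ((h - g) / h) = h * (h - g) * (1 + y)"
      using h by (simp add: power2_eq_square flip: h(2))
    finally have kD: "real k / D = (b - a) * (h * (h - g) * (1 + y))" .
    have gy: "g * y = \<beta> * (h - g)" using g by (simp add: y_def)
    \<comment> \<open>The factor \<open>g\<close> clears the denominator of \<open>y\<close>,
      leaving a polynomial identity modulo the relations for \<open>g * y\<close>,
      \<open>g^2\<close> and \<open>h^2\<close>.\<close>
    have "g * (h * (h - g) * (1 + y) - y) = g * ((1 - \<beta>) * (h - g)\<^sup>2)"
      using gy g2 h(2) by algebra
    then have "h * (h - g) * (1 + y) - y = (1 - \<beta>) * (h - g)\<^sup>2" using g by simp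
    then have "(b - a) * (h * (h - g) * (1 + y)) - (b - a) * y = (b - a) * (1 - \<beta>) * (h - g)\<^sup>2"
      by (simp flip: right_diff_distrib)
    then have "x + real k / D = a + (b - a) * (1 - \<beta>) * (h - g)\<^sup>2"
      unfolding kD x_def by linarith
    then show ?thesis using below[OF xa] le by linarith
  qed
  then show ?thesis by (simp add: h_def g_def \<kappa>_def)
qed

section \<open>Reversal: from the operator to derivatives\<close>

text \<open>In the product rule the term from \<open>x^d\<close> cancels against
  \<open>d * x * p\<close>, and the chain rule factor \<open>-1 / x^2\<close> against
  \<open>x^2\<close>. Here \<open>d\<close> need not be the degree of \<open>q\<close>.\<close>

lemma poly_polar_op_reversed:
  assumes "\<And>x. x \<noteq> 0 \<Longrightarrow> poly p x = x ^ d * poly q (1 / x)" and "x \<noteq> 0"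
  shows "poly (polar_op d p) x = x ^ d * poly (- pderiv q) (1 / x)"
proof -
  have 1: "(poly p has_field_derivative poly (pderiv p) x) (at x)" by (rule poly_DERIV)
  have 2: "((\<lambda>x. x ^ d * poly q (1 / x)) has_field_derivative
      real d * x ^ (d - 1) * poly q (1 / x) + x ^ d * (poly (pderiv q) (1 / x) * (- 1 / x\<^sup>2))) (at x)"
    using assms(2)
    by (auto intro!: derivative_eq_intros DERIV_chain2[OF poly_DERIV] simp: power2_eq_square)
  have 3: "(poly p has_field_derivative
      real d * x ^ (d - 1) * poly q (1 / x) + x ^ d * (poly (pderiv q) (1 / x) * (- 1 / x\<^sup>2))) (at x)"
    by (rule has_field_derivative_transform_within_open[OF 2, of "- {0}"]) (use assms in auto)
  have "x\<^sup>2 * poly (pderiv p) x =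
      real d * (x\<^sup>2 * x ^ (d - 1)) * poly q (1 / x) - x ^ d * poly (pderiv q) (1 / x)"
    unfolding DERIV_unique[OF 1 3] using assms(2) by (simp add: field_simps)
  \<comment> \<open>For \<open>d = 0\<close> the exponent \<open>d - 1\<close> truncates, but both
    sides vanish.\<close>
  also have "real d * (x\<^sup>2 * x ^ (d - 1)) = real d * (x * x ^ d)"
    by (cases d) (simp_all add: power2_eq_square)
  finally show ?thesis
    using assms by (simp add: polar_op_def poly_monom)
qed

text \<open>The one-step rule iterates with the same \<open>d\<close>, although differentiation
  lowers the degree of the reversed polynomial.\<close>

lemma poly_funpow_polar_op_reversed:
  assumes "\<And>x. x \<noteq> 0 \<Longrightarrow> poly p x = x ^ d * poly q (1 / x)" and "x \<noteq> 0"
  shows "poly ((polar_op d ^^ k) p) x = x ^ d * ((-1) ^ k * poly ((pderiv ^^ k) q) (1 / x))"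
  using assms(2)
proof (induction k arbitrary: x)
  case (Suc k)
  have "poly (polar_op d ((polar_op d ^^ k) p)) x =
      x ^ d * poly (- pderiv (smult ((-1) ^ k) ((pderiv ^^ k) q))) (1 / x)"
    using Suc by (intro poly_polar_op_reversed) auto
  then show ?case by (simp add: pderiv_smult)
qed (use assms in simp)

text \<open>Nonzero roots of \<open>p\<close> are reciprocals of entries of \<open>rs\<close>; a
  root at 0 is harmless since \<open>1 / B > 0\<close>. The root set is shown finite and nonempty so
  that \<open>Max\<close> is meaningful.\<close>

lemma maxroot_reversed_le:
  fixes rs :: "real list"
  assumes rev: "\<And>x. x \<noteq> 0 \<Longrightarrow> poly p x = x ^ d * (c * poly (root_poly rs) (1 / x))" and "c \<noteq> 0"
    and "rs \<noteq> []" "0 < B" "\<forall>r\<in>set rs. B \<le> r"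
  shows "maxroot p \<le> 1 / B"
proof -
  have root: "1 / x \<in> set rs" if "poly p x = 0" "x \<noteq> 0" for x
    using that rev[of x] assms(2) by simp
  have "{x. poly p x = 0} \<subseteq> insert 0 ((\<lambda>r. 1 / r) ` set rs)"
  proof
    fix x assume "x \<in> {x. poly p x = 0}"
    then have "x = 0 \<or> 1 / x \<in> set rs" using root by blast
    then show "x \<in> insert 0 ((\<lambda>r. 1 / r) ` set rs)" by (auto simp: image_iff intro!: bexI[of _ "1 / x"])
  qed
  then have fin: "finite {x. poly p x = 0}" by (rule finite_subset) auto
  obtain r where r: "r \<in> set rs" using assms(3) by (cases rs) auto
  then have "r > 0" using assms(4,5) by force
  then have "poly p (1 / r) = 0" using rev[of "1 / r"] r by simp
  moreover have "x \<le> 1 / B" if "poly p x = 0" for x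
  proof (cases "x > 0")
    case True
    then have "B \<le> 1 / x" using root[OF that] assms(5) by auto
    then show ?thesis using True assms(4) by (simp add: field_simps)
  next
    case False
    then show ?thesis using assms(4) by (meson divide_nonneg_pos not_less order_trans zero_le_one)
  qed
  ultimately show ?thesis unfolding maxroot_def using fin by (subst Max_le_iff) auto
qed

text \<open>Factor by factor,
  \<open>x - \<lambda> = x * (-\<lambda>) * (1 / x - 1 / \<lambda>)\<close>.\<close>

lemma poly_prod_reversed:
  fixes lam :: "nat \<Rightarrow> real"
  assumes "\<And>i. i \<in> {1..t} \<Longrightarrow> lam i \<noteq> 0" and "x \<noteq> 0" "t \<le> d"
  shows "poly (monom 1 (d - t) * (\<Prod>i=1..t. [:- lam i, 1:])) x =
    x ^ d * ((\<Prod>i=1..t. - lam i) * poly (root_poly (map (\<lambda>i. inverse (lam i)) [1..<Suc t])) (1 / x))"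
proof -
  have "x ^ d = x ^ (d - t) * x ^ t" using assms(3) by (simp flip: power_add)
  moreover have "(\<Prod>i=1..t. x - lam i) = x ^ t * ((\<Prod>i=1..t. - lam i) * (\<Prod>i=1..t. 1 / x - inverse (lam i)))"
  proof -
    have "(\<Prod>i=1..t. x - lam i) = (\<Prod>i=1..t. x * (- lam i * (1 / x - inverse (lam i))))"
      using assms by (intro prod.cong) (auto simp: field_simps)
    then show ?thesis by (simp only: prod.distrib) simp
  qed
  moreover have "poly (root_poly (map (\<lambda>i. inverse (lam i)) [1..<Suc t])) z =
      (\<Prod>i=1..t. z - inverse (lam i))" for z
    by (simp add: root_poly_def o_def poly_prod prod.distinct_set_conv_list[symmetric]
        atLeastLessThanSuc_atLeastAtMost del: upt_Suc)
  ultimately show ?thesis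
    by (simp add: poly_monom poly_prod mult_ac del: upt_Suc)
qed

section \<open>Translating the root bound back to the original polynomial\<close>

theorem theorem3p1:
  fixes d t :: nat and lam :: "nat \<Rightarrow> real" and p :: "real poly" and \<alpha> \<beta> :: real
  assumes "0 < t" and "t \<le> d"
    and "\<And>i j. 1 \<le> i \<Longrightarrow> i \<le> j \<Longrightarrow> j \<le> t \<Longrightarrow> lam j \<le> lam i"
    and "lam t > 0" and "lam 1 > lam t"
    and "p = monom 1 (d - t) * (\<Prod>i=1..t. [:- lam i, 1:])"
    and "\<alpha> = real t / (\<Sum>i=1..t. inverse (lam i))"
    and "\<beta> = (inverse (lam t) - inverse \<alpha>) / (inverse (lam t) - inverse (lam 1))"
  shows "\<beta> \<le> 1 \<and>
    (\<forall>k::int. \<beta> * real t \<le> of_int k \<and> k < int t \<longrightarrow>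
      maxroot ((polar_op d ^^ nat k) p)
        \<le> lam 1 / (1 + (lam 1 / \<alpha> - 1) *
            (sqrt (of_int k / real t) - sqrt (\<beta> / (1 - \<beta>) * (1 - of_int k / real t)))\<^sup>2))"
proof -
  \<comment> \<open>The extreme roots of the reversed polynomial and the mean of its roots.\<close>
  define a b m where "a = inverse (lam 1)" and "b = inverse (lam t)" and "m = inverse \<alpha>"
  have lam: "lam i > 0" "lam i \<le> lam 1" "lam t \<le> lam i" if "i \<in> {1..t}" for i
    using that assms(3)[of i t] assms(3)[of 1 i] assms(4) by auto
  have ab: "a < b" and a: "0 < a"
    using assms(4,5) by (auto simp: a_def b_def)
  have mem: "a \<le> inverse (lam i)" "inverse (lam i) \<le> b" if "i \<in> {1..t}" for i
    using lam[OF that] assms(4) by (auto simp: a_def b_def)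
  have t: "real t > 0" using assms(1) by simp
  have m: "(\<Sum>i=1..t. inverse (lam i)) = real t * m"
    using t by (simp add: m_def assms(7))
  \<comment> \<open>Strict because the term at \<open>i = 1\<close> is \<open>a < b\<close>. With
    the mirrored estimate at \<open>i = t\<close> this puts \<open>\<beta>\<close> strictly between
    0 and 1.\<close>
  have "(\<Sum>i=1..t. inverse (lam i)) < (\<Sum>i=1..t. b)"
    using mem ab assms(1) by (intro sum_strict_mono_ex1) (auto simp: a_def intro!: bexI[of _ 1])
  then have "real t * m < real t * b" unfolding m by simp
  then have mb: "m < b" using t by simp
  have "(\<Sum>i=1..t. a) < (\<Sum>i=1..t. inverse (lam i))"
    using mem ab assms(1) by (intro sum_strict_mono_ex1) (auto simp: b_def intro!: bexI[of _ t])
  then have "real t * a < real t * m" unfolding m by simp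
  then have am: "a < m" using t by simp
  have \<beta>: "\<beta> = (b - m) / (b - a)" by (simp add: assms(8) a_def b_def m_def)
  have \<beta>01: "0 < \<beta>" "\<beta> < 1" using mb am ab by (auto simp: \<beta> field_simps)
  define rs where "rs = map (\<lambda>i. inverse (lam i)) [1..<Suc t]"
  have len: "length rs = t" by (simp add: rs_def del: upt_Suc)
  have set_rs: "\<forall>r\<in>set rs. a \<le> r \<and> r \<le> b"
    using mem by (auto simp: rs_def simp del: upt_Suc)
  have "(\<Sum>r\<leftarrow>rs. b - r) = (\<Sum>i=1..t. b - inverse (lam i))"
    by (simp add: rs_def o_def sum.distinct_set_conv_list[symmetric]
        atLeastLessThanSuc_atLeastAtMost del: upt_Suc)
  also have "\<dots> = \<beta> * (b - a) * real t"
    proof -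
    have "\<beta> * (b - a) = b - m" using ab by (simp add: \<beta>)
    then show ?thesis by (simp only: sum_subtractf m) (simp add: algebra_simps)
  qed
  finally have mean: "(\<Sum>r\<leftarrow>rs. b - r) = \<beta> * (b - a) * real (length rs)" by (simp add: len)
  have rev: "poly p x = x ^ d * poly (smult (\<Prod>i=1..t. - lam i) (root_poly rs)) (1 / x)"
    if "x \<noteq> 0" for x
    unfolding assms(6) rs_def poly_smult
    by (rule poly_prod_reversed) (use lam that assms(2) in force)+
  have "maxroot ((polar_op d ^^ nat k) p)
        \<le> lam 1 / (1 + (lam 1 / \<alpha> - 1) *
            (sqrt (of_int k / real t) - sqrt (\<beta> / (1 - \<beta>) * (1 - of_int k / real t)))\<^sup>2)"
    if k: "\<beta> * real t \<le> of_int k" "k < int t" for k :: int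
  proof -
    define E where "E = (sqrt (of_int k / real t) - sqrt (\<beta> / (1 - \<beta>) * (1 - of_int k / real t)))\<^sup>2"
    define B where "B = a + (b - a) * (1 - \<beta>) * E"
    \<comment> \<open>A negative \<open>k\<close> is excluded by \<open>\<beta> > 0\<close>, so
      \<open>nat k\<close> loses nothing.\<close>
    have "0 \<le> real_of_int k" using k(1) \<beta>01 t by (meson mult_nonneg_nonneg less_imp_le order_trans)
    then have k0: "k \<ge> 0" by simp
    then have kr: "real (nat k) = of_int k" by simp
    have klt: "nat k < length rs" using k k0 assms(1) by (simp add: len nat_less_iff)
    obtain c rs' where c: "c \<noteq> 0" and len': "length rs' = length rs - nat k"
      and eq: "(pderiv ^^ nat k) (root_poly rs) = smult c (root_poly rs')"
      using higher_pderiv_splits[OF klt] by metis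
    have "B \<le> r" if "r \<in> set rs'" for r
    proof -
      have "poly ((pderiv ^^ nat k) (root_poly rs)) r = 0" using that by (simp add: eq)
      then show ?thesis
        using higher_pderiv_root_ge[OF ab set_rs mean \<beta>01 _ klt, of r] k(1)
        by (simp add: len kr B_def E_def)
    qed
    moreover have "B > 0" using a ab \<beta>01 unfolding B_def E_def
      by (intro add_pos_nonneg mult_nonneg_nonneg) auto
    moreover have "rs' \<noteq> []" using len' klt by auto
    moreover define C where "C = (-1) ^ nat k * ((\<Prod>i=1..t. - lam i) * c)"
    have "C \<noteq> 0" using c lam(1) by (force simp: C_def prod_zero_iff)
    moreover have "poly ((polar_op d ^^ nat k) p) x = x ^ d * (C * poly (root_poly rs') (1 / x))"
      if "x \<noteq> 0" for x
      using poly_funpow_polar_op_reversed[OF rev that, of "nat k"]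
      by (simp add: funpow_pderiv_smult eq C_def mult_ac)
    ultimately have "maxroot ((polar_op d ^^ nat k) p) \<le> 1 / B"
      by (intro maxroot_reversed_le) auto
    moreover have "B = a * (1 + (lam 1 / \<alpha> - 1) * E)"
    proof -
      \<comment> \<open>Hence \<open>B = a + (m - a) * E\<close>, and \<open>m / a\<close> is
        \<open>lam 1 / \<alpha>\<close>.\<close>
      have "(b - a) * (1 - \<beta>) = m - a" using ab by (simp add: \<beta> field_simps)
      then show ?thesis
        using lam(1)[of 1] assms(1) by (simp add: B_def a_def m_def field_simps)
    qed
    moreover have "1 / (a * z) = lam 1 / z" for z by (simp add: a_def divide_simps)
    ultimately show ?thesis by (simp only: E_def)
  qed
  then show ?thesis using \<beta>01 by auto
qed

end
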